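(* Let $X$ be a compact uniform space and let $f : X \to X$ be an injective continuous map. Suppose $f$ is positively topologically expansive. Then $X$ is finite.
   Context: A uniform space $(X,\mathcal{U})$ carries the topology in which a set $T\subseteq X$ is open iff for every $x\in T$ there is $U\in\mathcal{U}$ with $U[x]=\{y : (x,y)\in U\}\subseteq T$; topological terms refer to this topology, and compactness does not presuppose Hausdorff. A continuous map $f:X\to X$ on a topological space $X$ is positively topologically expansive if there is a neighborhood $U\subseteq X\times X$ (in the product topology) of the diagonal $\Delta_X=\{(x,x):x\in X\}$ such that for any $x,y\in X$ with $x\neq y$ there exists an integer $n\geq 0$ with $(f^n(x),f^n(y))\notin U$. *)

theory Defs
  imports Complex_Main
begin

text \<open>As in the usual definition, a neighborhood \<open>U\<close> of the diagonal need not be open; it only has to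
  contain an open set of the product topology that includes the diagonal \<open>Id\<close>. Continuity of
  \<open>f\<close> is not part of this predicate and is to be assumed separately.\<close>

definition positively_topologically_expansive :: "('a::topological_space \<Rightarrow> 'a) \<Rightarrow> bool" where
  "positively_topologically_expansive f \<longleftrightarrow>
    (\<exists>U :: ('a \<times> 'a) set.
      (\<exists>V. open V \<and> Id \<subseteq> V \<and> V \<subseteq> U) \<and>
      (\<forall>x y. x \<noteq> y \<longrightarrow> (\<exists>n::nat. ((f ^^ n) x, (f ^^ n) y) \<notin> U)))"

end

theory Submission
  imports Defs "HOL-Analysis.Elementary_Topology"
begin

text \<open>
  Say that two points are close at time \<open>n\<close> if \<open>(f\<^sup>n x, f\<^sup>n y) \<in> K\<close>, where \<open>K\<close> is a closed neighbourhood
  of the diagonal inside the expansivity neighbourhood. The decisive fact is that closeness propagates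
  backwards in time. If \<open>x\<close> and \<open>y\<close> are not close at time 0, then \<open>x \<noteq> y\<close>, so \<open>f x \<noteq> f y\<close> by injectivity,
  and expansivity applied to \<open>f x\<close> and \<open>f y\<close> separates the orbits at some positive time; compactness
  bounds this time by one \<open>N\<close> for all such pairs (lemma \<open>uniform_return_of_separation\<close>). Read
  contrapositively, closeness at the times \<open>1, \<dots>, N\<close> forces closeness at time 0, hence closeness
  during any window of \<open>N\<close> consecutive times forces closeness at every earlier time
  (lemma \<open>backward_propagation\<close>).

  Compactness also gives a finite labelling of the space under which equally labelled points are
  close (lemma \<open>finite_labelling_near_diagonal\<close>), so only finitely many label words of length \<open>N\<close> exist.
  Given more distinct points than words, at each time \<open>m\<close> two of them have the same word on the window
  starting at \<open>m\<close>. Some fixed pair does so for infinitely many \<open>m\<close>; by backward propagation it is close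
  at all times, which contradicts expansivity.

  The uniform structure enters through the regularity of its topology, which supplies the closed
  neighbourhood \<open>K\<close> (lemma \<open>uniform_space_regular\<close>).
\<close>

text \<open>
  For a symmetric entourage \<open>E\<close> whose square is so small that it leads from \<open>x\<close> only into \<open>A\<close>, every
  point in the closure of the \<open>E\<close>-neighbourhood of \<open>x\<close> is two \<open>E\<close>-steps away from \<open>x\<close>, hence in \<open>A\<close>.
\<close>

lemma uniform_space_regular:
  fixes x :: "'a::uniform_space"
  assumes "open A" "x \<in> A"
  shows "\<exists>B. open B \<and> x \<in> B \<and> closure B \<subseteq> A"
proof -
  have "eventually (\<lambda>(x', y). x' = x \<longrightarrow> y \<in> A) uniformity"
    using assms by (simp add: open_uniformity)
  then obtain D where D: "eventually D uniformity"
    and DD: "\<And>a b c. D (a, b) \<Longrightarrow> D (b, c) \<Longrightarrow> a = x \<longrightarrow> c \<in> A"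
    by (rule uniformity_transE) auto
  define E where "E = (\<lambda>(a, b). D (a, b) \<and> D (b, a))"
  have "eventually (\<lambda>(a, b). D (b, a)) uniformity"
    using uniformity_sym[OF D] by simp
  with D have E: "eventually E uniformity"
    by eventually_elim (auto simp: E_def)
  have nhd: "eventually (\<lambda>b. E (a, b)) (nhds a)" for a
    unfolding eventually_nhds_uniformity
    using E by (rule eventually_mono) auto
  obtain B where B: "open B" "x \<in> B" "\<And>y. y \<in> B \<Longrightarrow> E (x, y)"
    using nhd[of x] unfolding eventually_nhds by blast
  have "y \<in> A" if y: "y \<in> closure B" for y
  proof -
    obtain C where C: "open C" "y \<in> C" "\<And>z. z \<in> C \<Longrightarrow> E (y, z)"
      using nhd[of y] unfolding eventually_nhds by blast
    then obtain z where "z \<in> B" "z \<in> C"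
      using y C by (metis disjoint_iff open_Int_closure_eq_empty)
    then have "D (x, z)" "D (z, y)" using B C by (auto simp: E_def)
    then show ?thesis using DD by blast
  qed
  with B show ?thesis by blast
qed

text \<open>
  Cover the space by finitely many open sets \<open>B\<close> with \<open>closure B \<times> closure B \<subseteq> V\<close> and label each point by
  one of the \<open>B\<close> that contain it. The unions of the squares of the \<open>B\<close> and of their closures are
  neighbourhoods of the diagonal, the former open and the latter closed.
\<close>

lemma finite_labelling_near_diagonal:
  fixes V :: "('a::uniform_space \<times> 'a) set"
  assumes "compact (UNIV :: 'a set)" "open V" "Id \<subseteq> V"
  obtains W K and g :: "'a \<Rightarrow> 'a set"
  where "open W" "Id \<subseteq> W" "W \<subseteq> K" "closed K" "K \<subseteq> V"
    "finite (range g)" "\<And>x y. g x = g y \<Longrightarrow> (x, y) \<in> W"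
proof -
  have "\<exists>B. open B \<and> x \<in> B \<and> closure B \<times> closure B \<subseteq> V" for x :: 'a
  proof -
    have "(x, x) \<in> V" using assms(3) by auto
    then obtain A1 A2 where "open A1" "open A2" "(x, x) \<in> A1 \<times> A2" "A1 \<times> A2 \<subseteq> V"
      using open_prod_elim[OF assms(2)] by metis
    moreover obtain B where "open B" "x \<in> B" "closure B \<subseteq> A1 \<inter> A2"
      using uniform_space_regular[of "A1 \<inter> A2" x] calculation by auto
    ultimately show ?thesis by blast
  qed
  then obtain B where B: "\<And>x. open (B x)" "\<And>x. x \<in> B x" "\<And>x. closure (B x) \<times> closure (B x) \<subseteq> V"
    by metis
  obtain F where F: "finite F" "UNIV \<subseteq> (\<Union>c\<in>F. B c)"
    by (rule compactE_image[OF assms(1), of UNIV B]) (use B in auto)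
  define h where "h x = (SOME c. c \<in> F \<and> x \<in> B c)" for x
  have h: "h x \<in> F \<and> x \<in> B (h x)" for x
    unfolding h_def by (rule someI_ex) (use F in blast)
  define g where "g = (\<lambda>x. B (h x))"
  define W where "W = (\<Union>c\<in>F. B c \<times> B c)"
  define K where "K = (\<Union>c\<in>F. closure (B c) \<times> closure (B c))"
  have gW: "(x, y) \<in> W" if "g x = g y" for x y
    using h[of x] h[of y] that unfolding g_def W_def by auto
  show thesis
  proof
    show "open W" using B unfolding W_def by (auto intro: open_Times)
    show "Id \<subseteq> W" using gW by auto
    show "W \<subseteq> K" unfolding W_def K_def by (intro UN_mono Sigma_mono closure_subset order_refl)
    show "closed K" unfolding K_def using F by (auto intro!: closed_UN closed_Times)
    show "K \<subseteq> V" unfolding K_def by (intro UN_least B(3))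
    show "finite (range g)"
      by (rule finite_subset[of _ "B ` F"]) (use h F in \<open>auto simp: g_def\<close>)
  qed (rule gW)
qed

lemma continuous_on_funpow_UNIV:
  fixes f :: "'a::topological_space \<Rightarrow> 'a"
  assumes "continuous_on UNIV f"
  shows "continuous_on UNIV (f ^^ n)"
proof (induction n)
  case (Suc n)
  then show ?case
    using continuous_on_compose[OF Suc continuous_on_subset[OF assms subset_UNIV]] by simp
qed (simp add: id_def)

text \<open>
  The pairs outside \<open>W\<close> form a compact set, and those whose orbits leave \<open>K\<close> at time \<open>n\<close> form an open set
  because \<open>K\<close> is closed. Injectivity ensures that the open sets with \<open>n \<ge> 1\<close> already cover.
\<close>

lemma uniform_return_of_separation:
  fixes f :: "'a::topological_space \<Rightarrow> 'a"
  assumes "compact (UNIV :: 'a set)" "inj f" "continuous_on UNIV f"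
    and "open W" "Id \<subseteq> W" "closed K"
    and exp: "\<And>x y. x \<noteq> y \<Longrightarrow> \<exists>n. ((f ^^ n) x, (f ^^ n) y) \<notin> K"
  obtains N where
    "\<And>x y. (x, y) \<notin> W \<Longrightarrow> \<exists>n\<in>{1..N}. ((f ^^ n) x, (f ^^ n) y) \<notin> K"
proof -
  define S where "S n = (\<lambda>p. ((f ^^ n) (fst p), (f ^^ n) (snd p))) -` (- K)" for n
  have opS: "open (S n)" for n
  proof -
    have c: "continuous_on UNIV (f ^^ n)" using continuous_on_funpow_UNIV[OF assms(3)] .
    show ?thesis unfolding S_def using assms(6)
      by (intro open_vimage) (auto intro!: continuous_on_Pair continuous_on_compose2[OF c]
          continuous_on_fst continuous_on_snd continuous_on_id)
  qed
  have "compact (UNIV \<times> UNIV :: ('a \<times> 'a) set)"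
    using assms(1) by (intro compact_Times)
  then have "compact (- W)"
    using compact_Int_closed[of UNIV "- W"] assms(4) by (simp add: closed_def)
  moreover have "- W \<subseteq> (\<Union>n\<in>{1..}. S n)"
  proof
    fix p assume "p \<in> - W"
    then have "f (fst p) \<noteq> f (snd p)"
      using assms(2,5) by (cases p) (auto dest: injD)
    then obtain n where "((f ^^ n) (f (fst p)), (f ^^ n) (f (snd p))) \<notin> K" using exp by blast
    then have "p \<in> S (Suc n)" unfolding S_def by (simp add: funpow_Suc_right del: funpow.simps)
    then show "p \<in> (\<Union>n\<in>{1..}. S n)" by auto
  qed
  ultimately obtain I where I: "I \<subseteq> {1..}" "finite I" "- W \<subseteq> (\<Union>n\<in>I. S n)"
    using compactE_image[of "- W" "{1..}" S] opS by metis
  then obtain N where "\<And>n. n \<in> I \<Longrightarrow> n \<le> N"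
    by (metis finite_nat_set_iff_bounded_le)
  with I have "\<exists>n\<in>{1..N}. ((f ^^ n) x, (f ^^ n) y) \<notin> K" if "(x, y) \<notin> W" for x y
    using that unfolding S_def by fastforce
  then show thesis using that by blast
qed

text \<open>
  The window is extended to the left one time at a time, so the induction runs downwards from its
  right end \<open>m + N\<close>.
\<close>

lemma backward_propagation:
  fixes P :: "nat \<Rightarrow> bool"
  assumes step: "\<And>k. (\<And>n. n \<in> {1..N} \<Longrightarrow> P (k + n)) \<Longrightarrow> P k"
    and window: "\<And>n. n < N \<Longrightarrow> P (m + n)"
    and "k < m + N"
  shows "P k"
  using assms(3)
proof (induction "m + N - k" arbitrary: k rule: less_induct)
  case less
  show ?case
  proof (cases "k \<ge> m")
    case True
    then show ?thesis using window[of "k - m"] less.prems by auto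
  next
    case False
    show ?thesis
    proof (rule step)
      show "P (k + n)" if "n \<in> {1..N}" for n
        using less.hyps[of "k + n"] that False by auto
    qed
  qed
qed

theorem proposition4p5:
  fixes f :: "'a::uniform_space \<Rightarrow> 'a"
  assumes "compact (UNIV :: 'a set)"
    and "inj f"
    and "continuous_on UNIV f"
    and "positively_topologically_expansive f"
  shows "finite (UNIV :: 'a set)"
proof (rule ccontr)
  assume inf: "infinite (UNIV :: 'a set)"
  obtain V where V: "open V" "Id \<subseteq> V"
    and exp: "\<And>x y. x \<noteq> y \<Longrightarrow> \<exists>n. ((f ^^ n) x, (f ^^ n) y) \<notin> V"
    using assms(4) unfolding positively_topologically_expansive_def by (meson subsetD)
  obtain W K and g :: "'a \<Rightarrow> 'a set" where W: "open W" "Id \<subseteq> W" "W \<subseteq> K"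
    and K: "closed K" "K \<subseteq> V"
    and g: "finite (range g)" "\<And>x y. g x = g y \<Longrightarrow> (x, y) \<in> W"
    using finite_labelling_near_diagonal[OF assms(1) V] by metis
  have expK: "\<exists>n. ((f ^^ n) x, (f ^^ n) y) \<notin> K" if "x \<noteq> y" for x y
    using exp[OF that] K by blast
  obtain N where N: "\<And>x y. (x, y) \<notin> W \<Longrightarrow> \<exists>n\<in>{1..N}. ((f ^^ n) x, (f ^^ n) y) \<notin> K"
    using uniform_return_of_separation[OF assms(1-3) W(1,2) K(1) expK] by metis
  define close where "close x y n \<longleftrightarrow> ((f ^^ n) x, (f ^^ n) y) \<in> K" for x y n
  have step: "close x y k" if "\<And>n. n \<in> {1..N} \<Longrightarrow> close x y (k + n)" for x y k
  proof (rule ccontr)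
    assume "\<not> close x y k"
    then have "((f ^^ k) x, (f ^^ k) y) \<notin> W" using W unfolding close_def by auto
    then obtain n where "n \<in> {1..N}" "((f ^^ n) ((f ^^ k) x), (f ^^ n) ((f ^^ k) y)) \<notin> K"
      using N by blast
    with that[of n] show False unfolding close_def by (simp add: funpow_add add.commute[of k])
  qed
  define word where "word m x = map (\<lambda>n. g ((f ^^ (m + n)) x)) [0..<N]" for m x
  define L where "L = {w. set w \<subseteq> range g \<and> length w = N}"
  have "finite L" unfolding L_def using g(1) by (rule finite_lists_length_eq)
  have word_L: "word m x \<in> L" for m x by (auto simp: word_def L_def)
  obtain X :: "'a set" where X: "finite X" "card X = Suc (card L)"
    using infinite_arbitrarily_large[OF inf] by blast
  have "\<exists>p \<in> X \<times> X. fst p \<noteq> snd p \<and> word m (fst p) = word m (snd p)" for m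
  proof -
    have "card (word m ` X) \<le> card L"
      using word_L \<open>finite L\<close> by (intro card_mono) auto
    then have "\<not> inj_on (word m) X" using X by (intro pigeonhole) simp
    then show ?thesis unfolding inj_on_def by fastforce
  qed
  then obtain p where p: "\<And>m. p m \<in> X \<times> X" "\<And>m. fst (p m) \<noteq> snd (p m)"
      "\<And>m. word m (fst (p m)) = word m (snd (p m))"
    by metis
  have "finite (range p)" using p(1) X(1) by (meson finite_SigmaI finite_subset image_subsetI)
  then obtain m0 where m0: "infinite {m. p m = p m0}"
    using pigeonhole_infinite[of UNIV p] by auto
  obtain x y where xy: "p m0 = (x, y)" by fastforce
  have "close x y k" for k
  proof -
    obtain m where m: "m > k" "p m = p m0"
      using m0 unfolding infinite_nat_iff_unbounded by blast
    have eq: "word m x = word m y" using p(3)[of m] m xy by simp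
    have window: "close x y (m + n)" if "n < N" for n
    proof -
      have "word m x ! n = word m y ! n" using eq by simp
      then have "g ((f ^^ (m + n)) x) = g ((f ^^ (m + n)) y)"
        using that by (simp add: word_def)
      then show ?thesis using g(2) W(3) unfolding close_def by blast
    qed
    show ?thesis
      using backward_propagation[of N "close x y" m k, OF step window] m(1) by simp
  qed
  moreover have "x \<noteq> y" using p(2)[of m0] xy by simp
  ultimately show False using expK unfolding close_def by blast
qed

end
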